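(* Let $d,m\ge 1$, let $A$ be the weighted arithmetic average operator associated with weights $\alpha_1,\dots,\alpha_m$ and points $x_1,\dots,x_m\in\mathbb{R}^d$, let $c\in(0,1)$, and let $g,h:\mathbb{R}^d\to\mathbb{R}$ satisfy $Ag\ge g$, $Ah=h$ and $0\vee g\le h$. Let $\mathcal{D}$ be the operator $f\mapsto (c\cdot Af)\vee g$ and let $q_n:=\mathcal{D}^n(g\vee 0)$ for $n\in\mathbb{N}_0$. Then for all $n\in\mathbb{N}=\{1,2,\dots\}$, $$\left\|q_{n+1}-q_n\right\|\ \le\ c\cdot\left\|q_n-q_{n-1}\right\| ,$$ where $\|\cdot\|$ is the supremum norm over $\mathbb{R}^d$.
   Context: The weights $\alpha_1,\dots,\alpha_m\in[0,1]$ satisfy $\sum_{k=1}^m\alpha_k=1$, and $x_1,\dots,x_m\in\mathbb{R}^d$. The weighted arithmetic average operator $A$ acts on functions $f:\mathbb{R}^d\to\mathbb{R}$ by $(Af)(y)=\sum_{k=1}^m\alpha_k f(y-x_k)$ for $y\in\mathbb{R}^d$. The function $g$ is measurable. The operator $\mathcal{D}$ is defined on the cone of nonnegative measurable functions $f:\mathbb{R}^d\to\mathbb{R}$ by $\mathcal{D}f=(c\cdot Af)\vee g$, where $\vee$ denotes the pointwise maximum; $\mathcal{D}^n$ is its $n$-fold iterate ($\mathcal{D}^0$ is the identity). All inequalities between functions are pointwise. For $f:\mathbb{R}^d\to\mathbb{R}$, $\|f\|=\sup_{y\in\mathbb{R}^d}|f(y)|\in[0,\infty]$, with $c\cdot\infty=\infty$.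 $\mathbb{N}_0=\{0,1,2,\dots\}$. *)

theory Defs
  imports "HOL-Analysis.Analysis"
begin

definition weighted_avg ::
    "nat \<Rightarrow> (nat \<Rightarrow> real) \<Rightarrow> (nat \<Rightarrow> real ^ 'd) \<Rightarrow> (real ^ 'd \<Rightarrow> real) \<Rightarrow> (real ^ 'd \<Rightarrow> real)"
  where "weighted_avg m \<alpha> x f = (\<lambda>y. \<Sum>k = 1..m. \<alpha> k * f (y - x k))"

text \<open>
  The operator \<open>f \<mapsto> (c \<cdot> A f) \<or> g\<close> is meant for the cone of nonnegative measurable functions;
  it is written down for all functions. For weights \<open>\<alpha> k \<ge> 0\<close>, \<open>c \<ge> 0\<close> and
  measurable \<open>g\<close> it maps that cone into itself, so its iterates there never leave the cone.
\<close>

definition D_op ::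
    "nat \<Rightarrow> (nat \<Rightarrow> real) \<Rightarrow> (nat \<Rightarrow> real ^ 'd) \<Rightarrow> real \<Rightarrow> (real ^ 'd \<Rightarrow> real) \<Rightarrow>
     (real ^ 'd \<Rightarrow> real) \<Rightarrow> (real ^ 'd \<Rightarrow> real)"
  where "D_op m \<alpha> x c g f = (\<lambda>y. max (c * weighted_avg m \<alpha> x f y) (g y))"

text \<open>
  The supremum norm takes values in \<open>[0, \<infinity>]\<close>, since the functions need not be bounded.
  In \<^typ>\<open>ennreal\<close>, a positive real times \<open>\<infinity>\<close> is \<open>\<infinity>\<close>.
\<close>

definition sup_norm :: "(real ^ 'd \<Rightarrow> real) \<Rightarrow> ennreal"
  where "sup_norm f = (SUP y. ennreal \<bar>f y\<bar>)"

end

theory Submission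
  imports Defs
begin

text \<open>The operator \<open>D_op m \<alpha> x c g\<close> is Lipschitz with constant
  \<open>c\<close> for the supremum distance, even when that distance is infinite: averaging with
  nonnegative weights of total at most 1 cannot increase the distance, scaling contributes the
  factor \<open>c\<close>, and taking the maximum with the fixed function \<open>g\<close> is
  pointwise 1-Lipschitz. This is \<open>sup_norm_D_op_diff_le\<close>. The theorem applies it to the
  consecutive iterates \<open>q n\<close> and \<open>q (n - 1)\<close>, whose images are
  \<open>q (n + 1)\<close> and \<open>q n\<close>.\<close>

lemma sup_norm_D_op_diff_le:
  fixes f f' g :: "real ^ 'd \<Rightarrow> real"
  assumes nonneg: "\<And>k. k \<in> {1..m} \<Longrightarrow> 0 \<le> \<alpha> k"
    and sum_le: "(\<Sum>k = 1..m. \<alpha> k) \<le> 1"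
    and c: "0 \<le> c"
  shows "sup_norm (\<lambda>y. D_op m \<alpha> x c g f y - D_op m \<alpha> x c g f' y)
    \<le> ennreal c * sup_norm (\<lambda>y. f y - f' y)"
proof -
  define S where "S = sup_norm (\<lambda>y. f y - f' y)"
  have le_S: "ennreal \<bar>f z - f' z\<bar> \<le> S" for z
    unfolding S_def sup_norm_def by (rule SUP_upper) simp
  have "ennreal \<bar>D_op m \<alpha> x c g f y - D_op m \<alpha> x c g f' y\<bar> \<le> ennreal c * S" for y
  proof -
    let ?d = "\<lambda>k. f (y - x k) - f' (y - x k)"
    \<comment> \<open>Both maxima share the entry \<open>g y\<close>, and
      \<open>\<bar>max a b - max a' b\<bar> \<le> \<bar>a - a'\<bar>\<close>.\<close>
    have "\<bar>D_op m \<alpha> x c g f y - D_op m \<alpha> x c g f' y\<bar>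
        \<le> \<bar>c * weighted_avg m \<alpha> x f y - c * weighted_avg m \<alpha> x f' y\<bar>"
      unfolding D_op_def by linarith
    also have "\<dots> = c * \<bar>\<Sum>k = 1..m. \<alpha> k * ?d k\<bar>"
      using c unfolding weighted_avg_def right_diff_distrib[symmetric]
      by (simp add: abs_mult right_diff_distrib flip: sum_subtractf)
    also have "\<dots> \<le> c * (\<Sum>k = 1..m. \<alpha> k * \<bar>?d k\<bar>)"
      using c nonneg
      by (intro mult_left_mono order_trans[OF sum_abs] sum_mono) (auto simp: abs_mult)
    \<comment> \<open>The estimate moves to \<open>ennreal\<close> before the pointwise differences
      are replaced by \<open>S\<close>, because \<open>S\<close> may be infinite. Nonnegativity of
      \<open>c\<close> and of the weights lets \<open>ennreal\<close> pass through the products and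
      the sum.\<close>
    finally have "ennreal \<bar>D_op m \<alpha> x c g f y - D_op m \<alpha> x c g f' y\<bar>
        \<le> ennreal (c * (\<Sum>k = 1..m. \<alpha> k * \<bar>?d k\<bar>))"
      by (rule ennreal_leI)
    also have "\<dots> = ennreal c * (\<Sum>k = 1..m. ennreal (\<alpha> k) * ennreal \<bar>?d k\<bar>)"
      using c nonneg
      by (subst ennreal_mult', simp, subst sum_ennreal[symmetric]) (auto simp: ennreal_mult')
    \<comment> \<open>\<open>S\<close> bounds the difference at every point, hence at each shifted
      point \<open>y - x k\<close>.\<close>
    also have "\<dots> \<le> ennreal c * (\<Sum>k = 1..m. ennreal (\<alpha> k) * S)"
      by (intro mult_left_mono sum_mono le_S) auto
    also have "\<dots> = ennreal c * (ennreal (\<Sum>k = 1..m. \<alpha> k) * S)"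
      using nonneg by (subst sum_ennreal[symmetric]) (auto simp: sum_distrib_right)
    also have "\<dots> \<le> ennreal c * (1 * S)"
      using sum_le by (intro mult_left_mono mult_right_mono) auto
    finally show ?thesis by simp
  qed
  then show ?thesis
    unfolding sup_norm_def[of "\<lambda>y. D_op m \<alpha> x c g f y - D_op m \<alpha> x c g f' y"] S_def[symmetric]
    by (intro SUP_least)
qed

theorem theorem2:
  fixes m :: nat
    and \<alpha> :: "nat \<Rightarrow> real"
    and x :: "nat \<Rightarrow> real ^ 'd"
    and c :: real
    and g h :: "real ^ 'd \<Rightarrow> real"
    and q :: "nat \<Rightarrow> real ^ 'd \<Rightarrow> real"
    and n :: nat
  assumes "m \<ge> 1"
    and "\<And>k. k \<in> {1..m} \<Longrightarrow> \<alpha> k \<in> {0..1}"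
    and "(\<Sum>k = 1..m. \<alpha> k) = 1"
    and "c \<in> {0<..<1}"
    and "g \<in> borel_measurable borel"
    and "\<And>y. weighted_avg m \<alpha> x g y \<ge> g y"
    and "weighted_avg m \<alpha> x h = h"
    and "\<And>y. max 0 (g y) \<le> h y"
    and "\<And>n. q n = (D_op m \<alpha> x c g ^^ n) (\<lambda>y. max (g y) 0)"
    and "n \<ge> 1"
  shows "sup_norm (\<lambda>y. q (n + 1) y - q n y) \<le> ennreal c * sup_norm (\<lambda>y. q n y - q (n - 1) y)"
proof -
  \<comment> \<open>Since \<open>n \<ge> 1\<close>, \<open>n - 1\<close> is a true predecessor
    rather than a truncated difference, so \<open>q n\<close> is itself an image under the
    operator.\<close>
  obtain p where n: "n = Suc p"
    using assms(10) by (cases n) auto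
  have step: "q (Suc k) = D_op m \<alpha> x c g (q k)" for k
    by (simp add: assms(9))
  have "sup_norm (\<lambda>y. D_op m \<alpha> x c g (q n) y - D_op m \<alpha> x c g (q p) y)
      \<le> ennreal c * sup_norm (\<lambda>y. q n y - q p y)"
    using assms(2-4) by (intro sup_norm_D_op_diff_le) auto
  then show ?thesis
    using step[of n] step[of p] by (simp add: n)
qed

end
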